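(* Let $f:\mathcal{S}^{2\times 2}\to\mathbb{R}$ be a quadratic form. Then the three following statements are equivalent: (i) $f$ is symmetric polyconvex; (ii) there exist $\alpha\geq 0$ and a convex quadratic form $h:\mathcal{S}^{2\times 2}\to \mathbb{R}$ such that $f(\varepsilon)=h(\varepsilon)-\alpha\det\varepsilon$ for all $\varepsilon\in \mathcal{S}^{2\times 2}$; (iii) there exists $\alpha\geq 0$ such that $f(\varepsilon) +\alpha \det\varepsilon\geq 0$ for all $\varepsilon\in \mathcal{S}^{2\times 2}$.
   Context: $\mathcal{S}^{2\times 2}$ denotes the space of symmetric matrices in $\mathbb{R}^{2\times 2}$, and $F^s=\frac12(F+F^T)$. A quadratic form on $\mathcal{S}^{2\times 2}$ is a (homogeneous) quadratic function $f(\varepsilon)=M\varepsilon:\varepsilon$ with a fixed fourth-order tensor $M$, where $A:B=\sum_{i,j}A_{ij}B_{ij}$. A function $\tilde f:\mathbb{R}^{2\times 2}\to\mathbb{R}$ is polyconvex if there is a convex function $G:\mathbb{R}^{2\times 2}\times\mathbb{R}\to\mathbb{R}$ with $\tilde f(F)=G(F,\det F)$ for all $F\in\mathbb{R}^{2\times 2}$. A function $f:\mathcal{S}^{2\times 2}\to\mathbb{R}$ is symmetric polyconvex if $\tilde f:\mathbb{R}^{2\times 2}\to\mathbb{R}$, $\tilde f(F)=f(F^s)$, is polyconvex. *)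

theory Defs
  imports "HOL-Analysis.Analysis"
begin

text \<open>Functions on the space of symmetric matrices are represented by total functions on
  \<^typ>\<open>real^2^2\<close>; every notion below that concerns such a function depends only on its values
  on \<open>sym_matrices\<close>. The double contraction \<open>A : B\<close> is the library's inner
  product \<open>A \<bullet> B\<close> on \<^typ>\<open>real^2^2\<close>.\<close>

definition sym_matrices :: "(real^2^2) set" where
  "sym_matrices = {A. transpose A = A}"

definition sym_part :: "real^2^2 \<Rightarrow> real^2^2" where
  "sym_part F = (1/2) *\<^sub>R (F + transpose F)"

text \<open>A fourth-order tensor has components \<open>M $ i $ j $ k $ l\<close>; no symmetry of \<open>M\<close> is required.\<close>

definition tensor_app :: "real^2^2^2^2 \<Rightarrow> real^2^2 \<Rightarrow> real^2^2" where
  "tensor_app M A = (\<chi> i j. \<Sum>k\<in>UNIV. \<Sum>l\<in>UNIV. M $ i $ j $ k $ l * A $ k $ l)"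

definition quadratic_form_on_sym :: "(real^2^2 \<Rightarrow> real) \<Rightarrow> bool" where
  "quadratic_form_on_sym f \<longleftrightarrow>
     (\<exists>M. \<forall>\<epsilon>\<in>sym_matrices. f \<epsilon> = tensor_app M \<epsilon> \<bullet> \<epsilon>)"

definition polyconvex :: "(real^2^2 \<Rightarrow> real) \<Rightarrow> bool" where
  "polyconvex g \<longleftrightarrow>
     (\<exists>G :: (real^2^2) \<times> real \<Rightarrow> real. convex_on UNIV G \<and> (\<forall>F. g F = G (F, det F)))"

definition symmetric_polyconvex :: "(real^2^2 \<Rightarrow> real) \<Rightarrow> bool" where
  "symmetric_polyconvex f \<longleftrightarrow> polyconvex (\<lambda>F. f (sym_part F))"

end

theory Submission
  imports Defs
begin

text \<open>The determinant of a \<open>2 \<times> 2\<close> matrix is itself a quadratic form and splits orthogonally: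
  with \<open>w = (F\<^sub>1\<^sub>2 - F\<^sub>2\<^sub>1) / 2\<close> measuring the skew part of \<open>F\<close>, the mixed terms cancel and
  \<open>det F = det F\<^sup>s + w\<^sup>2\<close> (lemma \<open>det_eq_det_sym_part\<close>), so \<open>det F\<close> and \<open>det F\<^sup>s\<close> differ by a convex term.

  If \<open>f = h - \<alpha> det\<close> on symmetric matrices with \<open>h\<close> convex and \<open>\<alpha> \<ge> 0\<close>, then
  \<open>f (F\<^sup>s) = (h (F\<^sup>s) + \<alpha> w\<^sup>2) - \<alpha> det F\<close>, where the bracket is convex in \<open>F\<close> and the last term is
  linear in \<open>det F\<close>; so \<open>f\<close> is symmetric polyconvex.

  Conversely let \<open>f (F\<^sup>s) = G (F, det F)\<close> with \<open>G\<close> convex. Both \<open>f\<close> and \<open>det\<close> are even, so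
  convexity of \<open>G\<close> along the segment from \<open>(F, d)\<close> to \<open>(-F, d)\<close> gives
  \<open>G (0, det F) \<le> f (F\<^sup>s)\<close>: the whole matrix argument disappears. What remains is the convex
  function \<open>d \<mapsto> G (0, d)\<close> of one real variable, which vanishes at \<open>0\<close> and hence lies above a line
  \<open>c d\<close>. Thus \<open>f (F\<^sup>s) \<ge> c det F\<close> for every \<open>F\<close>. A rotation by a right angle has zero symmetric part
  and determinant \<open>1\<close>, which forces \<open>c \<le> 0\<close>, and \<open>\<alpha> = -c\<close> is the required number
  (lemma \<open>polyconvex_imp_det_bound\<close>).

  Finally, a bound \<open>f + \<alpha> det \<ge> 0\<close> on symmetric matrices gives the decomposition with
  \<open>h = f + \<alpha> det\<close>, because a nonnegative quadratic form is convex
  (lemma \<open>nonneg_quadratic_form_convex_on\<close>), and this closes the circle.\<close>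

lemma convex_on_compose_linear:
  assumes "convex_on T f" "linear A" "A ` S \<subseteq> T" "convex S"
  shows "convex_on S (\<lambda>x. f (A x))"
proof (rule convex_onI)
  fix t :: real and x y
  assume "0 < t" "t < 1" "x \<in> S" "y \<in> S"
  then show "f (A ((1 - t) *\<^sub>R x + t *\<^sub>R y)) \<le> (1 - t) * f (A x) + t * f (A y)"
    using convex_onD[OF assms(1), of t "A x" "A y"] assms(3)
    by (auto simp: linear_add[OF assms(2)] linear_scale[OF assms(2)])
qed (fact assms(4))

text \<open>The gap in the convexity inequality of a quadratic form is
  \<open>t (1 - t) B (x - y) (x - y)\<close>, that is, a value of the form itself.\<close>

lemma nonneg_quadratic_form_convex_on:
  fixes B :: "'a::real_vector \<Rightarrow> 'a \<Rightarrow> real"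
  assumes B: "bilinear B" and S: "subspace S" and nonneg: "\<And>x. x \<in> S \<Longrightarrow> B x x \<ge> 0"
  shows "convex_on S (\<lambda>x. B x x)"
proof (rule convex_onI)
  fix t :: real and x y
  assume t: "0 < t" "t < 1" and xy: "x \<in> S" "y \<in> S"
  have "B (x - y) (x - y) \<ge> 0"
    using nonneg S xy by (simp add: subspace_diff)
  then have "t * (1 - t) * B (x - y) (x - y) \<ge> 0"
    using t by simp
  moreover have "(1 - t) * B x x + t * B y y
      - B ((1 - t) *\<^sub>R x + t *\<^sub>R y) ((1 - t) *\<^sub>R x + t *\<^sub>R y)
      = t * (1 - t) * B (x - y) (x - y)"
    by (simp add: bilinear_ladd[OF B] bilinear_radd[OF B] bilinear_lmul[OF B] bilinear_rmul[OF B]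
        bilinear_lsub[OF B] bilinear_rsub[OF B] algebra_simps)
  ultimately show "B ((1 - t) *\<^sub>R x + t *\<^sub>R y) ((1 - t) *\<^sub>R x + t *\<^sub>R y)
      \<le> (1 - t) * B x x + t * B y y"
    by linarith
qed (fact subspace_imp_convex[OF S])

lemma convex_on_real_supporting_line:
  fixes k :: "real \<Rightarrow> real"
  assumes "convex_on UNIV k"
  obtains c where "\<And>d. k d \<ge> k x + c * (d - x)"
  using convex_le_Inf_differential[OF assms, of x] by auto

lemma subspace_sym_matrices: "subspace sym_matrices"
  by (auto simp: subspace_def sym_matrices_def transpose_def vec_eq_iff)

lemma sym_part_in_sym_matrices: "sym_part F \<in> sym_matrices"
  by (simp add: sym_part_def sym_matrices_def transpose_def vec_eq_iff)

lemma sym_part_of_sym: "\<epsilon> \<in> sym_matrices \<Longrightarrow> sym_part \<epsilon> = \<epsilon>"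
  by (simp add: sym_part_def sym_matrices_def flip: scaleR_2)

lemma linear_sym_part: "linear sym_part"
  by (rule linearI) (simp_all add: sym_part_def transpose_def vec_eq_iff algebra_simps)

lemma det_eq_det_sym_part:
  fixes F :: "real^2^2"
  shows "det F = det (sym_part F) + ((F$1$2 - F$2$1) / 2)\<^sup>2"
  by (simp add: det_2 sym_part_def transpose_def power2_eq_square field_simps)

lemma det_uminus_2: "det (- F) = det (F :: real^2^2)"
  by (simp add: det_2)

lemma bilinear_tensor_app: "bilinear (\<lambda>A B. tensor_app M A \<bullet> B)"
  unfolding bilinear_def
  by (auto intro!: linearI simp: tensor_app_def inner_vec_def sum_2 algebra_simps)

lemma tensor_app_add_left: "tensor_app (M + N) A = tensor_app M A + tensor_app N A"
  by (simp add: tensor_app_def vec_eq_iff sum_2 algebra_simps)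

lemma tensor_app_scaleR_left: "tensor_app (c *\<^sub>R M) A = c *\<^sub>R tensor_app M A"
  by (simp add: tensor_app_def vec_eq_iff sum_2 algebra_simps)

text \<open>Half the linear map that sends a matrix to its cofactor matrix, so that contracting with the
  argument again gives the determinant.\<close>

definition det_tensor :: "real^2^2^2^2" where
  "det_tensor = (\<chi> i j k l. if i \<noteq> k \<and> j \<noteq> l then (if i = j then 1/2 else - 1/2) else 0)"

lemma det_tensor_app: "tensor_app det_tensor A \<bullet> A = det A"
  by (simp add: tensor_app_def det_tensor_def inner_vec_def sum_2 det_2 algebra_simps)

lemma quadratic_form_on_sym_add_det:
  assumes "quadratic_form_on_sym f"
  shows "quadratic_form_on_sym (\<lambda>\<epsilon>. f \<epsilon> + \<alpha> * det \<epsilon>)"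
proof -
  obtain M where "\<And>\<epsilon>. \<epsilon> \<in> sym_matrices \<Longrightarrow> f \<epsilon> = tensor_app M \<epsilon> \<bullet> \<epsilon>"
    using assms by (auto simp: quadratic_form_on_sym_def)
  then have "\<forall>\<epsilon>\<in>sym_matrices. f \<epsilon> + \<alpha> * det \<epsilon> = tensor_app (M + \<alpha> *\<^sub>R det_tensor) \<epsilon> \<bullet> \<epsilon>"
    by (simp add: tensor_app_add_left tensor_app_scaleR_left inner_add_left det_tensor_app)
  then show ?thesis
    unfolding quadratic_form_on_sym_def by blast
qed

lemma quadratic_form_on_sym_zero: "quadratic_form_on_sym f \<Longrightarrow> f 0 = 0"
  using subspace_0[OF subspace_sym_matrices] by (auto simp: quadratic_form_on_sym_def)

lemma quadratic_form_on_sym_even: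
  assumes "quadratic_form_on_sym f" "\<epsilon> \<in> sym_matrices"
  shows "f (- \<epsilon>) = f \<epsilon>"
  using assms subspace_neg[OF subspace_sym_matrices]
  by (auto simp: quadratic_form_on_sym_def bilinear_lneg[OF bilinear_tensor_app])

lemma nonneg_quadratic_form_on_sym_convex:
  assumes h: "quadratic_form_on_sym h" and nonneg: "\<And>\<epsilon>. \<epsilon> \<in> sym_matrices \<Longrightarrow> h \<epsilon> \<ge> 0"
  shows "convex_on sym_matrices h"
proof -
  obtain M where M: "\<And>\<epsilon>. \<epsilon> \<in> sym_matrices \<Longrightarrow> h \<epsilon> = tensor_app M \<epsilon> \<bullet> \<epsilon>"
    using h by (auto simp: quadratic_form_on_sym_def)
  then have "convex_on sym_matrices (\<lambda>\<epsilon>. tensor_app M \<epsilon> \<bullet> \<epsilon>)"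
    using nonneg
    by (intro nonneg_quadratic_form_convex_on[OF bilinear_tensor_app subspace_sym_matrices])
      fastforce
  then show ?thesis
    using M subspace_sym_matrices by (auto simp: convex_on_def subspace_def)
qed

text \<open>Evenness turns \<open>(F, det F)\<close> and \<open>(-F, det F)\<close> into two points at which \<open>G\<close> takes the same
  value, with midpoint \<open>(0, det F)\<close>. So a supporting line of the convex
  function \<open>d \<mapsto> G (0, d)\<close> does the work of a supporting hyperplane of \<open>G\<close>.\<close>

lemma polyconvex_imp_det_bound:
  assumes poly: "symmetric_polyconvex f"
    and even: "\<And>\<epsilon>. \<epsilon> \<in> sym_matrices \<Longrightarrow> f (- \<epsilon>) = f \<epsilon>" and zero: "f 0 = 0"
  shows "\<exists>\<alpha>\<ge>0. \<forall>\<epsilon>\<in>sym_matrices. f \<epsilon> + \<alpha> * det \<epsilon> \<ge> 0"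
proof -
  obtain G :: "(real^2^2) \<times> real \<Rightarrow> real" where convG: "convex_on UNIV G"
    and G: "\<And>F. f (sym_part F) = G (F, det F)"
    using poly by (auto simp: symmetric_polyconvex_def polyconvex_def)
  have below: "G (0, det F) \<le> f (sym_part F)" for F
  proof -
    have "f (sym_part (- F)) = f (sym_part F)"
      by (simp add: linear_neg[OF linear_sym_part] even sym_part_in_sym_matrices)
    then have "G (- F, det F) = G (F, det F)"
      using G[of "- F"] G[of F] by (simp add: det_uminus_2)
    then show ?thesis
      using convex_onD[OF convG, of "1/2" "(F, det F)" "(- F, det F)"] G[of F]
      by (simp flip: scaleR_left_distrib)
  qed
  have at_zero: "G (0, 0) = 0"
    using G[of 0] zero by (simp add: linear_0[OF linear_sym_part] det_2)
  have "convex_on UNIV (\<lambda>d. G (0, d))"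
  proof (rule convex_onI)
    fix t d e :: real
    assume "0 < t" "t < 1"
    then show "G (0, (1 - t) *\<^sub>R d + t *\<^sub>R e) \<le> (1 - t) * G (0, d) + t * G (0, e)"
      using convex_onD[OF convG, of t "(0, d)" "(0, e)"] by simp
  qed simp
  then obtain c where "\<And>d. G (0, d) \<ge> G (0, 0) + c * (d - 0)"
    using convex_on_real_supporting_line[where x = 0] by metis
  then have bound: "c * det F \<le> f (sym_part F)" for F
    using below[of F] at_zero by (smt (verit) diff_zero)
  have "c \<le> 0"
  proof -
    \<comment> \<open>rotation by a right angle: skew-symmetric, with determinant \<open>1\<close>\<close>
    define J :: "real^2^2" where "J = (\<chi> i j. if i = j then 0 else if i = 1 then - 1 else 1)"
    have "det J = 1" "sym_part J = 0"
      by (simp_all add: J_def det_2 sym_part_def transpose_def vec_eq_iff forall_2)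
    then show ?thesis
      using bound[of J] zero by simp
  qed
  moreover have "f \<epsilon> + (- c) * det \<epsilon> \<ge> 0" if "\<epsilon> \<in> sym_matrices" for \<epsilon>
    using bound[of \<epsilon>] sym_part_of_sym[OF that] by simp
  ultimately show ?thesis
    by (intro exI[of _ "- c"]) auto
qed

text \<open>As a function of \<open>F\<close>, \<open>- \<alpha> det F\<^sup>s\<close> is not convex when \<open>\<alpha> > 0\<close>. Writing it as \<open>\<alpha> w\<^sup>2 - \<alpha> det F\<close> leaves a
  convex function of \<open>F\<close> and a term linear in the second argument of \<open>G\<close>; the sign of \<open>\<alpha>\<close> is what
  makes the square convex.\<close>

lemma convex_minus_det_imp_symmetric_polyconvex:
  assumes \<alpha>: "\<alpha> \<ge> 0" and h: "convex_on sym_matrices h"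
    and f: "\<And>\<epsilon>. \<epsilon> \<in> sym_matrices \<Longrightarrow> f \<epsilon> = h \<epsilon> - \<alpha> * det \<epsilon>"
  shows "symmetric_polyconvex f"
proof -
  define G :: "(real^2^2) \<times> real \<Rightarrow> real" where
    "G = (\<lambda>p. h (sym_part (fst p)) + \<alpha> * ((fst p $ 1 $ 2 - fst p $ 2 $ 1) / 2)\<^sup>2 + (- \<alpha> * snd p))"
  have "convex_on UNIV (\<lambda>p :: (real^2^2) \<times> real. h (sym_part (fst p)))"
    using linear_compose[OF linear_fst linear_sym_part]
    by (intro convex_on_compose_linear[OF h]) (auto simp: o_def sym_part_in_sym_matrices)
  moreover have "linear (\<lambda>p :: (real^2^2) \<times> real. (fst p $ 1 $ 2 - fst p $ 2 $ 1) / 2)"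
    by (rule linearI) (simp_all add: field_simps)
  then have "convex_on UNIV
      (\<lambda>p :: (real^2^2) \<times> real. \<alpha> * ((fst p $ 1 $ 2 - fst p $ 2 $ 1) / 2)\<^sup>2)"
    by (intro convex_on_cmul \<alpha> convex_on_compose_linear[OF convex_power2]) auto
  moreover have "convex_on UNIV (\<lambda>p :: (real^2^2) \<times> real. - \<alpha> * snd p)"
    by (rule convex_onI) (simp_all add: algebra_simps)
  ultimately have "convex_on UNIV G"
    unfolding G_def by (intro convex_on_add)
  moreover have "f (sym_part F) = G (F, det F)" for F
    using f[OF sym_part_in_sym_matrices[of F]] det_eq_det_sym_part[of F]
    by (simp add: G_def algebra_simps)
  ultimately show ?thesis
    unfolding symmetric_polyconvex_def polyconvex_def by blast
qed

theorem proposition4p5: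
  fixes f :: "real^2^2 \<Rightarrow> real"
  assumes "quadratic_form_on_sym f"
  shows "(symmetric_polyconvex f \<longleftrightarrow>
           (\<exists>\<alpha>\<ge>0. \<exists>h. quadratic_form_on_sym h \<and> convex_on sym_matrices h \<and>
              (\<forall>\<epsilon>\<in>sym_matrices. f \<epsilon> = h \<epsilon> - \<alpha> * det \<epsilon>))) \<and>
         (symmetric_polyconvex f \<longleftrightarrow>
           (\<exists>\<alpha>\<ge>0. \<forall>\<epsilon>\<in>sym_matrices. f \<epsilon> + \<alpha> * det \<epsilon> \<ge> 0))"
    (is "(?i \<longleftrightarrow> ?ii) \<and> (?i \<longleftrightarrow> ?iii)")
proof -
  have "?i \<Longrightarrow> ?iii"
    by (rule polyconvex_imp_det_bound)
      (simp_all add: quadratic_form_on_sym_even quadratic_form_on_sym_zero assms)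
  moreover have ?ii if iii: ?iii
  proof -
    obtain \<alpha> where \<alpha>: "\<alpha> \<ge> 0" "\<forall>\<epsilon>\<in>sym_matrices. f \<epsilon> + \<alpha> * det \<epsilon> \<ge> 0"
      using iii by blast
    have h: "quadratic_form_on_sym (\<lambda>\<epsilon>. f \<epsilon> + \<alpha> * det \<epsilon>)"
      by (rule quadratic_form_on_sym_add_det[OF assms])
    moreover have "convex_on sym_matrices (\<lambda>\<epsilon>. f \<epsilon> + \<alpha> * det \<epsilon>)"
      using nonneg_quadratic_form_on_sym_convex[OF h] \<alpha>(2) by blast
    ultimately show ?thesis
      using \<alpha>(1) by (intro exI[of _ \<alpha>] conjI exI[of _ "\<lambda>\<epsilon>. f \<epsilon> + \<alpha> * det \<epsilon>"]) simp_all
  qed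
  moreover have "?ii \<Longrightarrow> ?i"
    using convex_minus_det_imp_symmetric_polyconvex by blast
  ultimately show ?thesis
    by blast
qed

end
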